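(* Let $p$ be a minimal idempotent in $(\beta\mathbb{N}, +)$, let $\langle B_n \rangle_{n=1}^\infty$ be a sequence of members of $p$, let $\langle A_n \rangle_{n=1}^\infty$ be a sequence of finite image partition regular matrices with entries from $\mathbb{Q}$, and let $m_n$ be the number of columns of $A_n$ for each $n \in \mathbb{N}$. Then for each $n \in \mathbb{N}$ there exists $\vec{x}_n \in \mathbb{N}^{m_n}$ such that for every nonempty finite $F \subseteq \mathbb{N}$, $\sum_{n \in F} Y_n \subseteq B_{\min F}$, where $Y_n$ denotes the set of entries of $A_n \vec{x}_n$.
   Context: $\beta\mathbb{N}$ is the Stone–Čech compactification of the discrete space $\mathbb{N}$ (the set of ultrafilters on $\mathbb{N}$), with the extension of addition given by $p+q = \{A \subseteq \mathbb{N} : \{x : -x+A \in q\} \in p\}$, where $-x+A=\{y: x+y\in A\}$; this makes $\beta\mathbb{N}$ a compact right topological semigroup. A minimal idempotent is an idempotent lying in the smallest two-sided ideal $K(\beta\mathbb{N})$. A finite $u\times v$ matrix $A$ with rational entries is image partition regular (over $\mathbb{N}$) if for every finite coloring of $\mathbb{N}$ there is $\vec{x}\in\mathbb{N}^v$ such that all entries of $A\vec{x}$ are in $\mathbb{N}$ and have the same color. For a finite $F \subseteq \mathbb{N}$ and nonempty sets $Y_n$ ($n\in F$), $\sum_{n \in F} Y_n = \{\sum_{n \in F} a_n : a_n \in Y_n \text{ for each } n \in F\}$. *)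

theory Defs
  imports Complex_Main
begin

abbreviation PosNat :: "nat set" where "PosNat \<equiv> {1..}"

definition ultrafilter_N :: "nat set set \<Rightarrow> bool" where
  "ultrafilter_N U \<longleftrightarrow>
     U \<subseteq> Pow PosNat \<and> {} \<notin> U \<and> PosNat \<in> U \<and>
     (\<forall>A B. A \<in> U \<and> A \<subseteq> B \<and> B \<subseteq> PosNat \<longrightarrow> B \<in> U) \<and>
     (\<forall>A B. A \<in> U \<and> B \<in> U \<longrightarrow> A \<inter> B \<in> U) \<and>
     (\<forall>A. A \<subseteq> PosNat \<longrightarrow> A \<in> U \<or> PosNat - A \<in> U)"

definition betaN :: "nat set set set" where
  "betaN = {U. ultrafilter_N U}"

definition shift_N :: "nat \<Rightarrow> nat set \<Rightarrow> nat set" where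
  "shift_N x A = {y \<in> PosNat. x + y \<in> A}"

definition bplus :: "nat set set \<Rightarrow> nat set set \<Rightarrow> nat set set" where
  "bplus p q = {A. A \<subseteq> PosNat \<and> {x \<in> PosNat. shift_N x A \<in> q} \<in> p}"

definition two_sided_ideal :: "nat set set set \<Rightarrow> bool" where
  "two_sided_ideal I \<longleftrightarrow> I \<noteq> {} \<and> I \<subseteq> betaN \<and>
     (\<forall>p\<in>betaN. \<forall>q\<in>I. bplus p q \<in> I \<and> bplus q p \<in> I)"

definition K_betaN :: "nat set set set" where
  "K_betaN = \<Inter> {I. two_sided_ideal I}"

definition minimal_idempotent :: "nat set set \<Rightarrow> bool" where
  "minimal_idempotent p \<longleftrightarrow> p \<in> betaN \<and> bplus p p = p \<and> p \<in> K_betaN"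

text \<open>A \<open>u \<times> v\<close> rational matrix is a function \<open>nat \<Rightarrow> nat \<Rightarrow> rat\<close>, entries at
  \<open>i < u\<close>, \<open>j < v\<close>. Row \<open>i\<close> of \<open>A x\<close>:\<close>
definition mat_row :: "nat \<Rightarrow> (nat \<Rightarrow> nat \<Rightarrow> rat) \<Rightarrow> (nat \<Rightarrow> nat) \<Rightarrow> nat \<Rightarrow> rat" where
  "mat_row v A x i = (\<Sum>j<v. A i j * of_nat (x j))"

definition image_partition_regular :: "nat \<Rightarrow> nat \<Rightarrow> (nat \<Rightarrow> nat \<Rightarrow> rat) \<Rightarrow> bool" where
  "image_partition_regular u v A \<longleftrightarrow>
     (\<forall>(k::nat) (c::nat \<Rightarrow> nat). (\<forall>n\<in>PosNat. c n < k) \<longrightarrow>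
        (\<exists>x::nat \<Rightarrow> nat. (\<forall>j<v. x j \<in> PosNat) \<and>
           (\<exists>col. \<forall>i<u. \<exists>n\<in>PosNat. mat_row v A x i = of_nat n \<and> c n = col)))"

definition sumset :: "nat set \<Rightarrow> (nat \<Rightarrow> rat set) \<Rightarrow> rat set" where
  "sumset F Y = {(\<Sum>n\<in>F. a n) | a. \<forall>n\<in>F. a n \<in> Y n}"

end

theory Submission
  imports Defs "HOL-Library.Countable"
begin

text \<open>
  Let \<open>A\<close> be image partition regular. A colouring that records orders of magnitude yields a solution
  \<open>y = A x\<close> whose entries fall into classes: within a class they are nearly equal, between classes
  one entry is negligible against the other. Dividing by an entry of a class \<open>J\<close> shows that the cone
  \<open>{A g | g \<ge> 0}\<close>, restricted to \<open>J\<close> and the set \<open>R\<close> of rows of smaller magnitude, comes arbitrarily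
  close to the vector that is 1 on \<open>J\<close> and 0 on \<open>R\<close>; finitely generated cones being closed, it contains
  this vector. The nonnegativity of \<open>g\<close> is what keeps the solutions constructed below positive.

  Consequently every member \<open>C\<close> of a minimal idempotent contains all entries of some \<open>A x\<close>, by
  induction over the classes from the smallest upwards: given a sequence \<open>x t\<close> whose finite sums solve
  the rows \<open>R\<close> in \<open>C\<close>, choose \<open>a\<close> and \<open>H\<close> such that \<open>a + (\<Sum>t\<in>H. (A (x t)) i) \<in> C\<close> for \<open>i \<in> J\<close>, and pass to
  \<open>a g + (\<Sum>t\<in>H. x t)\<close>. Such \<open>a\<close> and \<open>H\<close> exist because, for fixed finitely many sequences, the
  ultrafilters all of whose members contain such a configuration form a two-sided ideal, which
  is nonempty by the van der Waerden theorem for finite sums. Idempotency alone then combines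
  the solutions for the individual matrices.
\<close>

subsection \<open>Van der Waerden's theorem for finite sums\<close>

text \<open>The base point \<open>a\<close> belongs to the monochromatic set. The sequences are
  integer-valued because the induction on their number passes to differences, which may be
  negative.\<close>

definition vdw_conf :: "(nat \<Rightarrow> nat \<Rightarrow> int) \<Rightarrow> nat \<Rightarrow> nat set \<Rightarrow> int set \<Rightarrow> (int \<Rightarrow> nat) \<Rightarrow> bool" where
  "vdw_conf y r T W c \<longleftrightarrow> (\<exists>a\<in>W. \<exists>H. H \<noteq> {} \<and> H \<subseteq> T \<and>
     (\<forall>j<r. a + sum (y j) H \<in> W \<and> c (a + sum (y j) H) = c a))"

text \<open>Colour focusing: \<open>b\<close> together with the \<open>s\<close> groups shows
  \<open>s + 1\<close> distinct colours, so \<open>s\<close> stays below the number of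
  colours.\<close>

definition focused_conf ::
    "(nat \<Rightarrow> nat \<Rightarrow> int) \<Rightarrow> nat \<Rightarrow> nat \<Rightarrow> nat set \<Rightarrow> int set \<Rightarrow> (int \<Rightarrow> nat) \<Rightarrow> bool" where
  "focused_conf y r s T W c \<longleftrightarrow> (\<exists>b\<in>W. \<exists>G col. 
     (\<forall>l<s. G l \<noteq> {} \<and> G l \<subseteq> T \<and>
       (\<forall>j<r. b + sum (y j) (G l) \<in> W \<and> c (b + sum (y j) (G l)) = col l)) \<and>
     inj_on col {..<s} \<and> c b \<notin> col ` {..<s})"

text \<open>The size of the range is bounded rather than the colours themselves, since encoded
  patterns are few in number but arbitrary as numbers.\<close>

definition bounded_colouring :: "nat \<Rightarrow> (int \<Rightarrow> nat) \<Rightarrow> bool" where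
  "bounded_colouring k c \<longleftrightarrow> finite (range c) \<and> card (range c) \<le> k"

lemma bounded_colouring_translate:
  assumes "bounded_colouring k c"
  shows "bounded_colouring k (\<lambda>w. c (a + w))"
proof -
  have "range (\<lambda>w. c (a + w)) \<subseteq> range c" by auto
  then show ?thesis using assms unfolding bounded_colouring_def
    by (meson card_mono finite_subset le_trans)
qed

lemma bounded_colouring_pattern:
  assumes "bounded_colouring k c"
  shows "bounded_colouring (k ^ length ws) (\<lambda>x. to_nat (map (\<lambda>w. c (x + w)) ws))"
proof -
  let ?L = "{xs. set xs \<subseteq> range c \<and> length xs = length ws}"
  have fin: "finite (range c)" and cd: "card (range c) \<le> k"
    using assms by (auto simp: bounded_colouring_def)
  have sub: "range (\<lambda>x. to_nat (map (\<lambda>w. c (x + w)) ws)) \<subseteq> to_nat ` ?L"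
    by (intro image_subsetI imageI CollectI conjI) auto
  have finL: "finite ?L" using fin by (rule finite_lists_length_eq)
  have "card (to_nat ` ?L) \<le> card ?L" using finL by (rule card_image_le)
  also have "\<dots> = card (range c) ^ length ws" using fin by (rule card_lists_length_eq)
  also have "\<dots> \<le> k ^ length ws" using cd by (rule power_mono) simp
  finally show ?thesis unfolding bounded_colouring_def
    using sub finL by (meson card_mono finite_imageI finite_subset le_trans)
qed

text \<open>Apply the case of \<open>r\<close> sequences to the differences \<open>y j - y r\<close> and to the colouring of \<open>x\<close> by the
  pattern of \<open>c\<close> on \<open>x + W\<close>; a focused configuration found near one of the resulting points is
  repeated near all of them, and refocusing it at the missing base point adds one more colour.
  The window \<open>W\<close> has to be independent of \<open>c\<close>, since otherwise the patterns would not form a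
  finite palette.\<close>

lemma focused_conf_step:
  fixes y :: "nat \<Rightarrow> nat \<Rightarrow> int"
  assumes IH: "\<And>(y :: nat \<Rightarrow> nat \<Rightarrow> int) n0 k. \<exists>W n1. finite W \<and>
        (\<forall>c. bounded_colouring k c \<longrightarrow> vdw_conf y r {n0..<n1} W c)"
  shows "\<exists>W n1. finite W \<and> (\<forall>c. bounded_colouring k c \<longrightarrow>
        vdw_conf y (Suc r) {n0..<n1} W c \<or> focused_conf y (Suc r) s {n0..<n1} W c)"
proof (induction s)
  case 0
  have "focused_conf y (Suc r) 0 {n0..<n0} {0} c" for c
    by (auto simp: focused_conf_def)
  then show ?case by blast
next
  case (Suc s)
  then obtain W n1 where W: "finite W" and Wc: "\<And>c. bounded_colouring k c \<Longrightarrow>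
      vdw_conf y (Suc r) {n0..<n1} W c \<or> focused_conf y (Suc r) s {n0..<n1} W c" by blast
  obtain ws where ws: "set ws = W" using W finite_list by blast
  define z where "z = (\<lambda>j t. y j t - y r t)"
  \<comment> \<open>Sets of indices from \<open>N1\<close> on are disjoint from those below
    \<open>n1\<close>, so sums over a union of the two kinds split.\<close>
  define N1 where "N1 = max n0 n1"
  obtain W' n2 where W': "finite W'" and W'c: "\<And>c. bounded_colouring (k ^ length ws) c \<Longrightarrow>
      vdw_conf z r {N1..<n2} W' c" using IH[where y=z] by blast
  define X where "X = (\<lambda>(a, G, w). a - sum (y r) G + w) ` (W' \<times> Pow {N1..<n2} \<times> W)"
  define W'' where "W'' = X \<union> (\<lambda>(a, w). a + w) ` (W' \<times> W)"
  have finW'': "finite W''" using W W' by (auto simp: W''_def X_def)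
  have sumW: "a + w \<in> W''" if "a \<in> W'" "w \<in> W" for a w
    using that by (auto simp: W''_def)
  define n3 where "n3 = max n1 n2"
  have sub1: "{n0..<n1} \<subseteq> {n0..<n3}" and sub2: "{N1..<n2} \<subseteq> {n0..<n3}"
    by (auto simp: n3_def N1_def)
  have "vdw_conf y (Suc r) {n0..<n3} W'' c \<or> focused_conf y (Suc r) (Suc s) {n0..<n3} W'' c"
    if c: "bounded_colouring k c" for c
  proof -
    let ?pat = "\<lambda>x. to_nat (map (\<lambda>w. c (x + w)) ws)"
    have "vdw_conf z r {N1..<n2} W' ?pat"
      by (rule W'c) (rule bounded_colouring_pattern[OF c])
    then obtain a G where a: "a \<in> W'" and G: "G \<noteq> {}" "G \<subseteq> {N1..<n2}"
      and aW: "\<And>j. j < r \<Longrightarrow> a + sum (z j) G \<in> W'"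
      and pat: "\<And>j. j < r \<Longrightarrow> ?pat (a + sum (z j) G) = ?pat a"
      unfolding vdw_conf_def by blast
    have z_sum: "sum (z j) G = sum (y j) G - sum (y r) G" for j
      by (simp add: z_def sum_subtractf)
    \<comment> \<open>As \<open>z r\<close> vanishes, the sequence with index \<open>r\<close>
      yields the base point \<open>a\<close>; this is how \<open>r\<close> sequences suffice for
      \<open>Suc r\<close>.\<close>
    have aW2: "a + sum (z j) G \<in> W'" if "j < Suc r" for j
      using that aW[of j] a by (cases "j = r") (auto simp: z_sum)
    have same: "c (a + sum (z j) G + w) = c (a + w)" if "j < Suc r" "w \<in> W" for j w
    proof (cases "j = r")
      case False
      then have "map (\<lambda>w. c (a + sum (z j) G + w)) ws = map (\<lambda>w. c (a + w)) ws"
        using pat[of j] that by (simp del: map_eq_conv)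
      then show ?thesis using that ws by auto
    qed (simp add: z_sum)
    have cases: "vdw_conf y (Suc r) {n0..<n1} W (\<lambda>w. c (a + w)) \<or>
        focused_conf y (Suc r) s {n0..<n1} W (\<lambda>w. c (a + w))"
      by (rule Wc) (rule bounded_colouring_translate[OF c])
    show ?thesis
    proof (cases "vdw_conf y (Suc r) {n0..<n1} W (\<lambda>w. c (a + w))")
      case True
      then obtain e H where e: "e \<in> W" "H \<noteq> {}" "H \<subseteq> {n0..<n1}"
        and eH: "\<And>j. j < Suc r \<Longrightarrow> e + sum (y j) H \<in> W \<and> c (a + (e + sum (y j) H)) = c (a + e)"
        unfolding vdw_conf_def by blast
      have "vdw_conf y (Suc r) {n0..<n3} W'' c"
        unfolding vdw_conf_def
      proof (intro bexI[of _ "a + e"] exI[of _ H] conjI allI impI)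
        show "a + e \<in> W''" using a e sumW by blast
        show "H \<noteq> {}" "H \<subseteq> {n0..<n3}" using e sub1 by auto
        fix j assume "j < Suc r"
        then show "a + e + sum (y j) H \<in> W''" "c (a + e + sum (y j) H) = c (a + e)"
          using eH[of j] sumW[OF a, of "e + sum (y j) H"] by (auto simp: add.assoc)
      qed
      then show ?thesis ..
    next
      case False
      then have "focused_conf y (Suc r) s {n0..<n1} W (\<lambda>w. c (a + w))"
        using cases by simp
      then obtain e G' col where e: "e \<in> W"
        and G'_all: "\<forall>l<s. G' l \<noteq> {} \<and> G' l \<subseteq> {n0..<n1} \<and> (\<forall>j<Suc r.
          e + sum (y j) (G' l) \<in> W \<and> c (a + (e + sum (y j) (G' l))) = col l)"
        and inj: "inj_on col {..<s}" and ce: "c (a + e) \<notin> col ` {..<s}"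
        unfolding focused_conf_def by (elim bexE exE conjE)
      have G': "\<And>l. l < s \<Longrightarrow> G' l \<noteq> {} \<and> G' l \<subseteq> {n0..<n1}"
        and eG: "\<And>l j. l < s \<Longrightarrow> j < Suc r \<Longrightarrow> e + sum (y j) (G' l) \<in> W"
        and ceG: "\<And>l j. l < s \<Longrightarrow> j < Suc r \<Longrightarrow> c (a + (e + sum (y j) (G' l))) = col l"
        using G'_all by simp_all
      \<comment> \<open>The shift by \<open>sum (y r) G\<close> makes \<open>b + sum (y j) G\<close>
        equal to \<open>a + sum (z j) G + e\<close>. Hence \<open>G\<close> alone is a group of
        colour \<open>c (a + e)\<close>, and adjoining \<open>G\<close> to an old group preserves
        its colour.\<close>
      define b where "b = a - sum (y r) G + e"
      define G2 where "G2 l = (if l < s then G' l \<union> G else G)" for l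
      define col2 where "col2 l = (if l < s then col l else c (a + e))" for l
      have "b \<in> X" unfolding X_def
        by (rule image_eqI[of _ _ "(a, G, e)"]) (use a e G in \<open>auto simp: b_def\<close>)
      then have b: "b \<in> W''" by (simp add: W''_def)
      have G2: "G2 l \<noteq> {} \<and> G2 l \<subseteq> {n0..<n3}" if "l < Suc s" for l
        using that G G'[of l] subset_trans[OF _ sub1] subset_trans[OF _ sub2] by (simp add: G2_def)
      have pts: "b + sum (y j) (G2 l) \<in> W'' \<and> c (b + sum (y j) (G2 l)) = col2 l"
        if l: "l < Suc s" and j: "j < Suc r" for l j
      proof (cases "l < s")
        case True
        have finG: "finite (G' l)" "finite G" using G' True G by (meson finite_atLeastLessThan finite_subset)+
        have disj: "G' l \<inter> G = {}" using G'[OF True] G by (fastforce simp: N1_def)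
        have eq: "b + sum (y j) (G2 l) = (a + sum (z j) G) + (e + sum (y j) (G' l))"
          using True finG disj by (simp add: G2_def b_def z_sum sum.union_disjoint)
        show ?thesis unfolding eq
          using sumW[OF aW2[OF j] eG[OF True j]] same[OF j eG[OF True j]] ceG[OF True j] True
          by (simp add: col2_def)
      next
        case False
        have eq: "b + sum (y j) (G2 l) = (a + sum (z j) G) + e"
          using False by (simp add: G2_def b_def z_sum)
        show ?thesis unfolding eq
          using sumW[OF aW2[OF j] e] same[OF j e] False by (simp add: col2_def)
      qed
      have inj2: "inj_on col2 {..<Suc s}"
      proof (rule inj_onI)
        have "col l \<noteq> c (a + e)" if "l < s" for l
          using ce that by (metis imageI lessThan_iff)
        moreover fix l l' assume "l \<in> {..<Suc s}" "l' \<in> {..<Suc s}" "col2 l = col2 l'"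
        ultimately show "l = l'" using inj_onD[OF inj, of l l']
          by (auto simp: col2_def less_Suc_eq split: if_splits)
      qed
      show ?thesis
      \<comment> \<open>If \<open>b\<close> repeats the colour of a group, it is the base point of a
        configuration with that group; otherwise all \<open>Suc s\<close> groups are focused at
        \<open>b\<close>.\<close>
      proof (cases "c b \<in> col2 ` {..<Suc s}")
        case True
        then obtain l where l: "l < Suc s" "c b = col2 l" by auto
        have "vdw_conf y (Suc r) {n0..<n3} W'' c"
          unfolding vdw_conf_def
          using G2[OF l(1)] pts[OF l(1)] l(2)
          by (intro bexI[OF _ b] exI[of _ "G2 l"]) simp
        then show ?thesis ..
      next
        case False
        have "focused_conf y (Suc r) (Suc s) {n0..<n3} W'' c"
          unfolding focused_conf_def
          using G2 pts inj2 False
          by (intro bexI[OF _ b] exI[of _ G2] exI[of _ col2] conjI allI impI) blast+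
        then show ?thesis ..
      qed
    qed
  qed
  then show ?case using finW'' by blast
qed

text \<open>A focused configuration with \<open>k\<close> groups would show \<open>k + 1\<close>
  colours, so only the other alternative of \<open>focused_conf_step\<close> remains. The free lower
  bound \<open>n0\<close> lets that step ask for later indices.\<close>

lemma ip_van_der_Waerden_finite:
  "\<exists>W n1. finite W \<and> (\<forall>c. bounded_colouring k c \<longrightarrow> vdw_conf y r {n0..<n1} W c)"
proof (induction r arbitrary: y n0 k)
  case 0
  have "vdw_conf y 0 {n0..<Suc n0} {0} c" for c
    by (auto simp: vdw_conf_def intro!: exI[of _ "{n0}"])
  then show ?case by blast
next
  case (Suc r)
  obtain W n1 where W: "finite W" and Wc: "\<And>c. bounded_colouring k c \<Longrightarrow>
        vdw_conf y (Suc r) {n0..<n1} W c \<or> focused_conf y (Suc r) k {n0..<n1} W c"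
    using focused_conf_step[OF Suc.IH, of k y n0 k] by blast
  have "\<not> focused_conf y (Suc r) k {n0..<n1} W c" if "bounded_colouring k c" for c
  proof
    assume "focused_conf y (Suc r) k {n0..<n1} W c"
    then obtain b G col where G_all: "\<forall>l<k. G l \<noteq> {} \<and> G l \<subseteq> {n0..<n1} \<and> (\<forall>j<Suc r.
          b + sum (y j) (G l) \<in> W \<and> c (b + sum (y j) (G l)) = col l)"
      and inj: "inj_on col {..<k}" and cb: "c b \<notin> col ` {..<k}"
      unfolding focused_conf_def by (elim bexE exE conjE)
    have G: "col l = c (b + sum (y 0) (G l))" if "l < k" for l
      using G_all that by simp
    have sub: "insert (c b) (col ` {..<k}) \<subseteq> range c" using G by auto
    have "card (insert (c b) (col ` {..<k})) = Suc k" using cb inj by (simp add: card_image)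
    then have "Suc k \<le> card (range c)" using sub that
      by (metis bounded_colouring_def card_mono)
    then show False using that by (simp add: bounded_colouring_def)
  qed
  then show ?case using W Wc by blast
qed

section \<open>Configurations in one cell of a finite partition\<close>

text \<open>Requiring \<open>a\<close> itself to lie in \<open>C\<close> allows divisibility
  conditions to be imposed on \<open>a\<close> through \<open>C\<close>.\<close>

definition contains_ip_config :: "nat \<Rightarrow> (nat \<Rightarrow> nat \<Rightarrow> int) \<Rightarrow> nat set \<Rightarrow> bool" where
  "contains_ip_config r y C \<longleftrightarrow> (\<exists>a\<in>C. \<exists>H. finite H \<and> H \<noteq> {} \<and>
     (\<forall>j<r. int a + sum (y j) H \<in> int ` C))"

text \<open>The finite window \<open>W\<close> is translated by \<open>M\<close> into the positive
  integers and coloured by the cell that contains the translate.\<close>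

lemma contains_ip_config_partition:
  assumes "finite \<X>" and cover: "PosNat \<subseteq> \<Union>\<X>"
  shows "\<exists>X\<in>\<X>. contains_ip_config r y X"
proof -
  obtain f :: "nat set \<Rightarrow> nat" where f: "inj_on f \<X>"
    using finite_imp_inj_to_nat_seg[OF assms(1)] by blast
  obtain W n1 where W: "finite W"
    and Wc: "\<And>c. bounded_colouring (Suc (card \<X>)) c \<Longrightarrow> vdw_conf y r {0..<n1} W c"
    using ip_van_der_Waerden_finite[of "Suc (card \<X>)" y r 0] by blast
  obtain M where M: "\<And>w. w \<in> W \<Longrightarrow> 1 \<le> w + M"
  proof -
    have "1 \<le> w + (1 + (\<Sum>v\<in>W. \<bar>v\<bar>))" if "w \<in> W" for w
      using member_le_sum[OF that, of abs] W by simp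
    then show ?thesis by (intro that[of "1 + (\<Sum>v\<in>W. \<bar>v\<bar>)"])
  qed
  define ch where "ch n = (SOME X. X \<in> \<X> \<and> n \<in> X)" for n :: nat
  have ch: "ch n \<in> \<X> \<and> n \<in> ch n" if "n \<in> PosNat" for n
    unfolding ch_def by (rule someI_ex) (use that cover in blast)
  define c where "c z = (if 1 \<le> z + M then f (ch (nat (z + M))) else 0)" for z
  have "range c \<subseteq> insert 0 (f ` \<X>)" using ch by (auto simp: c_def)
  then have "card (range c) \<le> card (insert 0 (f ` \<X>))" "finite (range c)"
    using assms(1) by (auto intro: card_mono finite_subset)
  moreover have "card (insert 0 (f ` \<X>)) \<le> Suc (card \<X>)"
    using card_image_le[OF assms(1), of f] by (simp add: card_insert_if assms(1))
  ultimately have "bounded_colouring (Suc (card \<X>)) c"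
    by (simp add: bounded_colouring_def)
  then obtain a H where a: "a \<in> W" and H: "H \<noteq> {}" "H \<subseteq> {0..<n1}"
    and aH: "\<And>j. j < r \<Longrightarrow> a + sum (y j) H \<in> W \<and> c (a + sum (y j) H) = c a"
    using Wc unfolding vdw_conf_def by blast
  let ?X = "ch (nat (a + M))"
  have aX: "?X \<in> \<X>" "nat (a + M) \<in> ?X" using ch[of "nat (a + M)"] M[OF a] by auto
  have "int (nat (a + M)) + sum (y j) H \<in> int ` ?X" if j: "j < r" for j
  proof -
    let ?b = "a + sum (y j) H"
    have b: "1 \<le> ?b + M" using aH[OF j] M by blast
    then have chb: "ch (nat (?b + M)) \<in> \<X>" "nat (?b + M) \<in> ch (nat (?b + M))"
      using ch[of "nat (?b + M)"] by auto
    have "f (ch (nat (?b + M))) = f ?X" using aH[OF j] b M[OF a] by (simp add: c_def)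
    then have "ch (nat (?b + M)) = ?X" using f chb aX by (auto dest: inj_onD)
    then have "nat (?b + M) \<in> ?X" using chb by simp
    moreover have "int (nat (a + M)) + sum (y j) H = int (nat (?b + M))" using b M[OF a] by simp
    ultimately show ?thesis by blast
  qed
  then have "contains_ip_config r y ?X"
    unfolding contains_ip_config_def using aX H by (meson finite_atLeastLessThan finite_subset)
  then show ?thesis using aX by blast
qed

subsection \<open>Rational polyhedral cones are closed\<close>

lemma rat_between_finite_sets:
  fixes L U :: "rat set"
  assumes "finite L" "finite U" "\<And>l u. l \<in> L \<Longrightarrow> u \<in> U \<Longrightarrow> l \<le> u"
  shows "\<exists>z. (\<forall>l\<in>L. l \<le> z) \<and> (\<forall>u\<in>U. z \<le> u)"
proof (cases "L = {}")
  case True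
  then show ?thesis using assms(2) by (cases "U = {}") (auto intro: exI[of _ "Min U"])
next
  case False
  then show ?thesis using assms by (intro exI[of _ "Max L"]) auto
qed

text \<open>Fourier--Motzkin elimination of the last variable.\<close>

lemma linear_ineqs_approx_imp_exact:
  fixes T :: "((nat \<Rightarrow> rat) \<times> rat) set"
  assumes "finite T"
    and "\<And>\<epsilon>. \<epsilon> > 0 \<Longrightarrow> \<exists>g. \<forall>(a, c)\<in>T. (\<Sum>j<n. a j * g j) \<le> c + \<epsilon>"
  shows "\<exists>g. \<forall>(a, c)\<in>T. (\<Sum>j<n. a j * g j) \<le> c"
  using assms
proof (induction n arbitrary: T)
  case 0
  have "0 \<le> c" if "(a, c) \<in> T" for a c
  proof (rule field_le_epsilon)
    fix \<epsilon> :: rat assume "\<epsilon> > 0"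
    then show "0 \<le> c + \<epsilon>" using 0(2) that by fastforce
  qed
  then show ?case by auto
next
  case (Suc n)
  define P where "P = {t \<in> T. fst t n > 0}"
  define N where "N = {t \<in> T. fst t n < 0}"
  \<comment> \<open>Scaling makes the coefficient of the last variable 1 on \<open>P\<close> and -1
    on \<open>N\<close>, so it cancels in the sum.\<close>
  define comb where "comb = (\<lambda>(s, t). ((\<lambda>j. fst s j / fst s n + fst t j / - fst t n),
      snd s / fst s n + snd t / - fst t n) :: (nat \<Rightarrow> rat) \<times> rat)"
  define T' where "T' = {t \<in> T. fst t n = 0} \<union> comb ` (P \<times> N)"
  have fin: "finite P" "finite N" "finite T'"
    using Suc.prems(1) by (auto simp: P_def N_def T'_def)
  have comb_sum: "(\<Sum>j<n. fst (comb (s, t)) j * g j) =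
      (\<Sum>j<n. fst s j * g j) / fst s n + (\<Sum>j<n. fst t j * g j) / - fst t n" for s t g
    by (simp add: comb_def sum_subtractf sum_divide_distrib algebra_simps)
  have "\<exists>g. \<forall>(a, c)\<in>T'. (\<Sum>j<n. a j * g j) \<le> c"
  proof (rule Suc.IH[OF fin(3)])
    fix \<epsilon> :: rat assume eps: "\<epsilon> > 0"
    \<comment> \<open>\<open>K\<close> bounds the scaling factors, so two scaled errors
      \<open>\<delta>\<close> amount to at most \<open>\<epsilon>\<close>. The summand 1 also
      ensures that \<open>\<delta>\<close> does not exceed \<open>\<epsilon>\<close>; zero
      coefficients contribute \<open>1 / 0 = 0\<close>.\<close>
    define K where "K = 1 + (\<Sum>t\<in>T. 1 / \<bar>fst t n\<bar>)"
    have K0: "K \<ge> 1" unfolding K_def by (simp add: sum_nonneg)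
    have Kt: "1 / \<bar>fst t n\<bar> \<le> K" if "t \<in> T" for t
      using member_le_sum[OF that, of "\<lambda>t. 1 / \<bar>fst t n\<bar>"] Suc.prems(1) by (simp add: K_def)
    define \<delta> where "\<delta> = \<epsilon> / (2 * K)"
    have delta: "\<delta> > 0" and dK: "\<delta> * K * 2 = \<epsilon>" using eps K0 by (auto simp: \<delta>_def)
    have "\<delta> * 1 \<le> \<delta> * K" using K0 delta by (intro mult_left_mono) auto
    then have dle: "\<delta> \<le> \<epsilon>" using dK eps by linarith
    obtain g where g: "\<And>t. t \<in> T \<Longrightarrow> (\<Sum>j<Suc n. fst t j * g j) \<le> snd t + \<delta>"
      using Suc.prems(2)[OF delta] unfolding case_prod_beta by blast
    have "(\<Sum>j<n. fst t j * g j) \<le> snd t + \<epsilon>" if tT': "t \<in> T'" for t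
    proof -
      consider "t \<in> T" "fst t n = 0" | p q where "p \<in> P" "q \<in> N" "t = comb (p, q)"
        using tT' unfolding T'_def by blast
      then show ?thesis
      proof cases
        case 1
        then show ?thesis using g[of t] dle by simp
      next
        case 2
        have p: "fst p n > 0" "p \<in> T" and q: "fst q n < 0" "q \<in> T"
          using 2 by (auto simp: P_def N_def)
        have "(\<Sum>j<n. fst p j * g j) / fst p n + g n \<le> snd p / fst p n + \<delta> / fst p n"
          using divide_right_mono[OF g[OF p(2)], of "fst p n"] p by (simp add: add_divide_distrib)
        moreover have "\<delta> / fst p n \<le> \<delta> * K"
          using mult_left_mono[OF Kt[OF p(2)], of \<delta>] p delta by simp
        moreover have "(\<Sum>j<n. fst q j * g j) / - fst q n - g n \<le> snd q / - fst q n + \<delta> / - fst q n"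
          using divide_right_mono[OF g[OF q(2)], of "- fst q n"] q
          by (simp add: add_divide_distrib diff_divide_distrib)
        moreover have "\<delta> / - fst q n \<le> \<delta> * K"
          using mult_left_mono[OF Kt[OF q(2)], of \<delta>] q delta by simp
        ultimately show ?thesis unfolding 2(3) comb_sum using dK by (simp add: comb_def)
      qed
    qed
    then show "\<exists>g. \<forall>(a, c)\<in>T'. (\<Sum>j<n. a j * g j) \<le> c + \<epsilon>" unfolding case_prod_beta by blast
  qed
  then obtain g where g: "\<And>t. t \<in> T' \<Longrightarrow> (\<Sum>j<n. fst t j * g j) \<le> snd t"
    unfolding case_prod_beta by blast
  \<comment> \<open>The bound that an inequality imposes on the eliminated variable: an upper bound
    on \<open>P\<close>, a lower bound on \<open>N\<close>.\<close>
  define b where "b t = (snd t - (\<Sum>j<n. fst t j * g j)) / fst t n" for t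
  have "b q \<le> b p" if "p \<in> P" "q \<in> N" for p q
  proof -
    have "(\<Sum>j<n. fst p j * g j) / fst p n + (\<Sum>j<n. fst q j * g j) / - fst q n
        \<le> snd p / fst p n + snd q / - fst q n"
    proof -
      have "comb (p, q) \<in> T'" using that unfolding T'_def by blast
      from g[OF this] show ?thesis unfolding comb_sum by (simp add: comb_def)
    qed
    then show ?thesis by (simp add: b_def diff_divide_distrib)
  qed
  then have "\<exists>z. (\<forall>l\<in>b ` N. l \<le> z) \<and> (\<forall>u\<in>b ` P. z \<le> u)"
    by (intro rat_between_finite_sets) (use fin in blast)+
  then obtain z where z: "\<And>q. q \<in> N \<Longrightarrow> b q \<le> z" "\<And>p. p \<in> P \<Longrightarrow> z \<le> b p"
    unfolding ball_simps by blast
  have "(\<Sum>j<Suc n. fst t j * (g(n := z)) j) \<le> snd t" if t: "t \<in> T" for t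
  proof -
    have eq: "(\<Sum>j<n. fst t j * (g(n := z)) j) = (\<Sum>j<n. fst t j * g j)"
      by (rule sum.cong) auto
    consider "fst t n = 0" | "fst t n > 0" | "fst t n < 0" by linarith
    then show ?thesis
    proof cases
      case 1
      then show ?thesis using g[of t] t eq by (simp add: T'_def)
    next
      case 2
      then have "z * fst t n \<le> snd t - (\<Sum>j<n. fst t j * g j)"
        using z(2)[of t] t by (simp add: P_def b_def pos_le_divide_eq)
      then show ?thesis using eq by (simp add: mult.commute)
    next
      case 3
      then have "z * fst t n \<le> snd t - (\<Sum>j<n. fst t j * g j)"
        using z(1)[of t] t by (simp add: N_def b_def neg_divide_le_eq)
      then show ?thesis using eq by (simp add: mult.commute)
    qed
  qed
  then show ?case unfolding case_prod_beta by blast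
qed

text \<open>Each equation becomes two inequalities and each sign condition becomes one, so the
  elimination lemma applies.\<close>

lemma cone_approx_imp_exact:
  fixes A :: "nat \<Rightarrow> nat \<Rightarrow> rat" and b :: "nat \<Rightarrow> rat"
  assumes R: "finite R"
    and approx: "\<And>\<epsilon>. \<epsilon> > 0 \<Longrightarrow>
      \<exists>g. (\<forall>j<v. g j \<ge> 0) \<and> (\<forall>i\<in>R. \<bar>(\<Sum>j<v. A i j * g j) - b i\<bar> \<le> \<epsilon>)"
  shows "\<exists>g. (\<forall>j<v. g j \<ge> 0) \<and> (\<forall>i\<in>R. (\<Sum>j<v. A i j * g j) = b i)"
proof -
  define T where "T = (\<lambda>i. (A i, b i)) ` R \<union> (\<lambda>i. (\<lambda>j. - A i j, - b i)) ` R
      \<union> (\<lambda>k. (\<lambda>j. if j = k then - 1 else 0, 0)) ` {..<v}"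
  have unit: "(\<Sum>j<v. (if j = k then - 1 else 0) * g j) = - g k" if "k < v" for k and g :: "nat \<Rightarrow> rat"
    using that by (simp add: if_distrib[of "\<lambda>x. x * _"] cong: if_cong)
  have "\<exists>g. \<forall>(a, c)\<in>T. (\<Sum>j<v. a j * g j) \<le> c"
  proof (rule linear_ineqs_approx_imp_exact)
    show "finite T" using R by (simp add: T_def)
    fix \<epsilon> :: rat assume eps: "\<epsilon> > 0"
    then obtain g where "\<forall>j<v. g j \<ge> 0" "\<forall>i\<in>R. \<bar>(\<Sum>j<v. A i j * g j) - b i\<bar> \<le> \<epsilon>"
      using approx by blast
    then have "\<forall>t\<in>T. (\<Sum>j<v. fst t j * g j) \<le> snd t + \<epsilon>"
      using eps by (auto simp: T_def unit sum_negf abs_le_iff)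
    then show "\<exists>g. \<forall>(a, c)\<in>T. (\<Sum>j<v. a j * g j) \<le> c + \<epsilon>"
      by (auto simp: case_prod_beta)
  qed
  then obtain g where g: "\<And>a c. (a, c) \<in> T \<Longrightarrow> (\<Sum>j<v. a j * g j) \<le> c" by blast
  have "g k \<ge> 0" if "k < v" for k
  proof -
    have "((\<lambda>j. if j = k then - 1 else 0, 0) :: (nat \<Rightarrow> rat) \<times> rat) \<in> T"
      using that by (auto simp: T_def)
    from g[OF this] show ?thesis by (simp add: unit[OF that])
  qed
  moreover have "(\<Sum>j<v. A i j * g j) = b i" if "i \<in> R" for i
  proof (rule antisym)
    have "(A i, b i) \<in> T" "(\<lambda>j. - A i j, - b i) \<in> T" using that by (auto simp: T_def)
    from this[THEN g] show "(\<Sum>j<v. A i j * g j) \<le> b i" "b i \<le> (\<Sum>j<v. A i j * g j)"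
      by (simp_all add: sum_negf)
  qed
  ultimately show ?thesis by blast
qed

subsection \<open>Ultrafilters\<close>

text \<open>\<open>PosNat\<close> abbreviates \<open>{1..}\<close>, and facts about it are no longer matched once the simplifier has
  turned it into \<open>{Suc 0..}\<close>.\<close>

declare One_nat_def [simp del]

lemma ultrafilter_mono: "ultrafilter_N p \<Longrightarrow> A \<in> p \<Longrightarrow> A \<subseteq> B \<Longrightarrow> B \<subseteq> PosNat \<Longrightarrow> B \<in> p"
  unfolding ultrafilter_N_def by blast

lemma ultrafilter_Int: "ultrafilter_N p \<Longrightarrow> A \<in> p \<Longrightarrow> B \<in> p \<Longrightarrow> A \<inter> B \<in> p"
  unfolding ultrafilter_N_def by blast

lemma ultrafilter_PosNat: "ultrafilter_N p \<Longrightarrow> PosNat \<in> p"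
  unfolding ultrafilter_N_def by simp

lemma ultrafilter_sub: "ultrafilter_N p \<Longrightarrow> A \<in> p \<Longrightarrow> A \<subseteq> PosNat"
  unfolding ultrafilter_N_def by auto

lemma ultrafilter_empty: "ultrafilter_N p \<Longrightarrow> {} \<notin> p"
  unfolding ultrafilter_N_def by simp

lemma ultrafilter_nonempty: "ultrafilter_N p \<Longrightarrow> A \<in> p \<Longrightarrow> \<exists>x. x \<in> A"
  using ultrafilter_empty by (metis equals0I)

lemma ultrafilter_compl: "ultrafilter_N p \<Longrightarrow> A \<subseteq> PosNat \<Longrightarrow> A \<in> p \<or> PosNat - A \<in> p"
  unfolding ultrafilter_N_def by simp

lemma ultrafilter_INT:
  assumes p: "ultrafilter_N p" and "finite I" "\<And>i. i \<in> I \<Longrightarrow> f i \<in> p"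
  shows "PosNat \<inter> (\<Inter>i\<in>I. f i) \<in> p"
  using assms(2,3)
proof (induction I rule: finite_induct)
  case empty
  then show ?case using ultrafilter_PosNat[OF p] by simp
next
  case (insert i I)
  note insert.prems[simp]
  have "f i \<inter> (PosNat \<inter> (\<Inter>i\<in>I. f i)) \<in> p" by (intro ultrafilter_Int[OF p] insert.IH) auto
  then show ?case by (simp add: Int_left_commute)
qed

lemma ultrafilter_finite_cover:
  assumes p: "ultrafilter_N p" and "finite I" "PosNat \<subseteq> (\<Union>i\<in>I. f i)"
    and sub: "\<And>i. i \<in> I \<Longrightarrow> f i \<subseteq> PosNat"
  shows "\<exists>i\<in>I. f i \<in> p"
proof (rule ccontr)
  assume "\<not> (\<exists>i\<in>I. f i \<in> p)"
  then have "PosNat - f i \<in> p" if "i \<in> I" for i using that ultrafilter_compl[OF p sub] by blast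
  then have "PosNat \<inter> (\<Inter>i\<in>I. PosNat - f i) \<in> p" using assms(2) by (intro ultrafilter_INT[OF p])
  moreover have "PosNat \<inter> (\<Inter>i\<in>I. PosNat - f i) = {}" using assms(3) by blast
  ultimately show False using ultrafilter_empty[OF p] by simp
qed

lemma shift_N_PosNat: "shift_N x PosNat = PosNat"
  by (auto simp: shift_N_def)

text \<open>The map \<open>?D\<close> is monotone and compatible with intersections and complements,
  because \<open>shift_N x\<close> is and \<open>q\<close> is an ultrafilter. The axioms for
  \<open>p\<close> therefore pull back along it.\<close>

lemma ultrafilter_bplus:
  assumes p: "ultrafilter_N p" and q: "ultrafilter_N q"
  shows "ultrafilter_N (bplus p q)"
proof -
  let ?D = "\<lambda>A. {x \<in> PosNat. shift_N x A \<in> q}"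
  have mono: "?D A \<subseteq> ?D B" if "A \<subseteq> B" for A B
  proof
    fix x assume "x \<in> ?D A"
    then show "x \<in> ?D B"
      using ultrafilter_mono[OF q, of "shift_N x A" "shift_N x B"] that by (auto simp: shift_N_def)
  qed
  have Dsub: "?D A \<subseteq> PosNat" for A by blast
  have inter: "?D A \<inter> ?D B \<subseteq> ?D (A \<inter> B)" for A B
  proof
    fix x assume "x \<in> ?D A \<inter> ?D B"
    moreover have "shift_N x (A \<inter> B) = shift_N x A \<inter> shift_N x B" by (auto simp: shift_N_def)
    ultimately show "x \<in> ?D (A \<inter> B)" using ultrafilter_Int[OF q] by auto
  qed
  have compl: "PosNat - ?D A \<subseteq> ?D (PosNat - A)" for A
  proof
    fix x assume x: "x \<in> PosNat - ?D A"
    have "shift_N x (PosNat - A) = PosNat - shift_N x A" by (auto simp: shift_N_def)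
    then show "x \<in> ?D (PosNat - A)"
      using x ultrafilter_compl[OF q, of "shift_N x A"] by (auto simp: shift_N_def)
  qed
  have D0: "?D {} = {}" using ultrafilter_empty[OF q] by (auto simp: shift_N_def)
  have D1: "?D PosNat = PosNat" using ultrafilter_PosNat[OF q] by (auto simp: shift_N_PosNat)
  have mem: "A \<in> bplus p q \<longleftrightarrow> A \<subseteq> PosNat \<and> ?D A \<in> p" for A by (simp add: bplus_def)
  show ?thesis
    unfolding ultrafilter_N_def
  proof (intro conjI allI impI)
    show "bplus p q \<subseteq> Pow PosNat" by (auto simp: bplus_def)
    show "{} \<notin> bplus p q" using ultrafilter_empty[OF p] by (simp only: mem D0) simp
    show "PosNat \<in> bplus p q" using ultrafilter_PosNat[OF p] by (simp only: mem D1) simp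
  next
    fix A B assume AB: "A \<in> bplus p q \<and> A \<subseteq> B \<and> B \<subseteq> PosNat"
    then have "?D A \<in> p" by (simp only: mem)
    then have "?D B \<in> p" by (rule ultrafilter_mono[OF p _ mono Dsub]) (use AB in simp)
    then show "B \<in> bplus p q" using AB by (simp only: mem)
  next
    fix A B assume "A \<in> bplus p q \<and> B \<in> bplus p q"
    then have AB: "A \<subseteq> PosNat" "?D A \<in> p" "?D B \<in> p" by (simp_all only: mem)
    then have "?D (A \<inter> B) \<in> p" by (intro ultrafilter_mono[OF p ultrafilter_Int[OF p] inter Dsub])
    then show "A \<inter> B \<in> bplus p q" using AB(1) by (simp only: mem) blast
  next
    fix A assume A: "A \<subseteq> PosNat"
    consider "?D A \<in> p" | "PosNat - ?D A \<in> p" using ultrafilter_compl[OF p Dsub] by blast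
    then show "A \<in> bplus p q \<or> PosNat - A \<in> bplus p q"
    proof cases
      case 1
      then have "A \<in> bplus p q" using A by (simp only: mem)
      then show ?thesis ..
    next
      case 2
      then have "?D (PosNat - A) \<in> p" by (rule ultrafilter_mono[OF p _ compl Dsub])
      then have "PosNat - A \<in> bplus p q" by (simp only: mem) blast
      then show ?thesis ..
    qed
  qed
qed

section \<open>Existence of ultrafilters\<close>

text \<open>The intersection with \<open>PosNat\<close> matters for the empty subfamily, whose
  intersection is the whole type.\<close>

definition has_fip :: "nat set set \<Rightarrow> bool" where
  "has_fip \<F> \<longleftrightarrow> \<F> \<subseteq> Pow PosNat \<and> (\<forall>\<G>. finite \<G> \<and> \<G> \<subseteq> \<F> \<longrightarrow> PosNat \<inter> \<Inter>\<G> \<noteq> {})"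

text \<open>Zorn's lemma gives a maximal family \<open>M\<close>. Maximality enters through
  \<open>memI\<close>: a set that meets every finite intersection of members of \<open>M\<close>
  belongs to \<open>M\<close>.\<close>

lemma has_fip_extends_to_ultrafilter:
  assumes "has_fip \<F>"
  shows "\<exists>p. ultrafilter_N p \<and> \<F> \<subseteq> p"
proof -
  let ?Z = "{\<G>. has_fip \<G> \<and> \<F> \<subseteq> \<G>}"
  have "\<exists>M\<in>?Z. \<forall>X\<in>?Z. M \<subseteq> X \<longrightarrow> X = M"
  proof (rule subset_Zorn_nonempty)
    show "?Z \<noteq> {}" using assms by blast
    fix \<C> assume ne: "\<C> \<noteq> {}" and ch: "subset.chain ?Z \<C>"
    have sub: "\<C> \<subseteq> ?Z" using ch by (simp add: subset.chain_def)
    have "PosNat \<inter> \<Inter>\<G> \<noteq> {}" if G: "finite \<G>" "\<G> \<subseteq> \<Union>\<C>" for \<G>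
    proof -
      obtain X where "X \<in> \<C>" "\<G> \<subseteq> X"
        using finite_subset_Union_chain[OF G ne ch] by blast
      then have "has_fip X" using sub by blast
      then show ?thesis using G(1) \<open>\<G> \<subseteq> X\<close> unfolding has_fip_def by blast
    qed
    moreover have "\<Union>\<C> \<subseteq> Pow PosNat" using sub unfolding has_fip_def by blast
    ultimately have "has_fip (\<Union>\<C>)" by (simp add: has_fip_def)
    then show "\<Union>\<C> \<in> ?Z" using ne sub by blast
  qed
  then obtain M where M_mem: "M \<in> ?Z" and M_max: "\<forall>X\<in>?Z. M \<subseteq> X \<longrightarrow> X = M" by (elim bexE)
  have M: "has_fip M" "\<F> \<subseteq> M" using M_mem by simp_all
  have max: "X = M" if "has_fip X" "M \<subseteq> X" for X
    using M_max[THEN bspec, of X] that M(2) by simp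
  have Msub: "M \<subseteq> Pow PosNat" using M(1) by (simp add: has_fip_def)
  have Mfip: "PosNat \<inter> \<Inter>\<G> \<noteq> {}" if "finite \<G>" "\<G> \<subseteq> M" for \<G>
    using M(1) that unfolding has_fip_def by simp
  have memI: "A \<in> M"
    if A: "A \<subseteq> PosNat" and fip: "\<And>\<G>. finite \<G> \<Longrightarrow> \<G> \<subseteq> M \<Longrightarrow> PosNat \<inter> \<Inter>\<G> \<inter> A \<noteq> {}" for A
  proof -
    have "has_fip (insert A M)"
      unfolding has_fip_def
    proof (intro conjI allI impI)
      show "insert A M \<subseteq> Pow PosNat" using A Msub by blast
      fix \<G> assume \<G>: "finite \<G> \<and> \<G> \<subseteq> insert A M"
      then have "PosNat \<inter> \<Inter>(\<G> - {A}) \<inter> A \<noteq> {}" by (intro fip) auto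
      then show "PosNat \<inter> \<Inter>\<G> \<noteq> {}" by blast
    qed
    from max[OF this] show ?thesis by blast
  qed
  have "ultrafilter_N M"
    unfolding ultrafilter_N_def
  proof (intro conjI allI impI)
    show "M \<subseteq> Pow PosNat" by fact
    show "{} \<notin> M" using Mfip[of "{{}}"] by auto
    show "PosNat \<in> M"
    proof (rule memI)
      fix \<G> assume "finite \<G>" "\<G> \<subseteq> M"
      then show "PosNat \<inter> \<Inter>\<G> \<inter> PosNat \<noteq> {}" using Mfip[of \<G>] by blast
    qed simp
  next
    fix A B assume AB: "A \<in> M \<and> A \<subseteq> B \<and> B \<subseteq> PosNat"
    show "B \<in> M"
    proof (rule memI)
      fix \<G> assume "finite \<G>" "\<G> \<subseteq> M"
      then show "PosNat \<inter> \<Inter>\<G> \<inter> B \<noteq> {}" using Mfip[of "insert A \<G>"] AB by auto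
    qed (use AB in blast)
  next
    fix A B assume AB: "A \<in> M \<and> B \<in> M"
    show "A \<inter> B \<in> M"
    proof (rule memI)
      show "A \<inter> B \<subseteq> PosNat" using AB Msub by blast
      fix \<G> assume "finite \<G>" "\<G> \<subseteq> M"
      then have "PosNat \<inter> \<Inter>(insert A (insert B \<G>)) \<noteq> {}" using AB by (intro Mfip) auto
      then show "PosNat \<inter> \<Inter>\<G> \<inter> (A \<inter> B) \<noteq> {}" by auto
    qed
  next
    fix A assume A: "A \<subseteq> PosNat"
    show "A \<in> M \<or> PosNat - A \<in> M"
    proof (rule ccontr)
      assume no: "\<not> (A \<in> M \<or> PosNat - A \<in> M)"
      obtain \<G> where \<G>: "finite \<G>" "\<G> \<subseteq> M" "PosNat \<inter> \<Inter>\<G> \<inter> A = {}"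
        using no memI[OF A] by blast
      obtain \<H> where \<H>: "finite \<H>" "\<H> \<subseteq> M" "PosNat \<inter> \<Inter>\<H> \<inter> (PosNat - A) = {}"
        using no memI[of "PosNat - A"] by blast
      have "PosNat \<inter> \<Inter>(\<G> \<union> \<H>) \<noteq> {}" using \<G> \<H> by (intro Mfip) auto
      then show False using \<G>(3) \<H>(3) by auto
    qed
  qed
  then show ?thesis using M(2) by blast
qed

section \<open>The ideal of ultrafilters whose members contain configurations\<close>

text \<open>If the complements of the configuration-free sets lacked the finite intersection
  property, finitely many configuration-free sets would cover \<open>PosNat\<close>.\<close>

lemma ip_ultrafilter_exists:
  "\<exists>p. ultrafilter_N p \<and> (\<forall>C\<in>p. contains_ip_config r y C)"
proof -
  let ?F = "{PosNat - X |X. X \<subseteq> PosNat \<and> \<not> contains_ip_config r y X}"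
  have "has_fip ?F"
    unfolding has_fip_def
  proof (intro conjI allI impI)
    show "?F \<subseteq> Pow PosNat" by auto
    fix \<G> assume \<G>: "finite \<G> \<and> \<G> \<subseteq> ?F"
    have no: "\<not> contains_ip_config r y X" if X: "X \<in> (\<lambda>Y. PosNat - Y) ` \<G>" for X
    proof -
      obtain Y where "Y \<in> \<G>" "X = PosNat - Y" using X by blast
      moreover from this obtain Z where "Y = PosNat - Z" "Z \<subseteq> PosNat" "\<not> contains_ip_config r y Z"
        using \<G> by blast
      ultimately show ?thesis by (simp add: double_diff)
    qed
    show "PosNat \<inter> \<Inter>\<G> \<noteq> {}"
    proof
      assume "PosNat \<inter> \<Inter>\<G> = {}"
      then have "PosNat \<subseteq> \<Union>((\<lambda>Y. PosNat - Y) ` \<G>)" by blast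
      then show False
        using contains_ip_config_partition[of "(\<lambda>Y. PosNat - Y) ` \<G>" r y] \<G> no by blast
    qed
  qed
  then obtain p where p: "ultrafilter_N p" "?F \<subseteq> p" using has_fip_extends_to_ultrafilter by blast
  have "contains_ip_config r y C" if C: "C \<in> p" for C
  proof (rule ccontr)
    assume "\<not> contains_ip_config r y C"
    then have "PosNat - C \<in> p" using p ultrafilter_sub[OF p(1) C] by blast
    then have "C \<inter> (PosNat - C) \<in> p" using ultrafilter_Int[OF p(1) C] by blast
    then show False using ultrafilter_empty[OF p(1)] by simp
  qed
  then show ?thesis using p by blast
qed

lemma two_sided_ideal_ip_ultrafilters:
  "two_sided_ideal {q \<in> betaN. \<forall>C\<in>q. contains_ip_config r y C}" (is "two_sided_ideal ?Q")
  unfolding two_sided_ideal_def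
proof (intro conjI ballI)
  obtain p where "ultrafilter_N p" "\<forall>C\<in>p. contains_ip_config r y C"
    using ip_ultrafilter_exists by blast
  then have "p \<in> ?Q" by (simp add: betaN_def)
  then show "?Q \<noteq> {}" by blast
  show "?Q \<subseteq> betaN" by blast
next
  fix p q assume p: "p \<in> betaN" and q: "q \<in> ?Q"
  have up: "ultrafilter_N p" and uq: "ultrafilter_N q" using p q by (auto simp: betaN_def)
  have cfg: "contains_ip_config r y C" if "C \<in> q" for C using q that by blast
  \<comment> \<open>Left multiplication: a configuration inside a single shift of \<open>C\<close>
    is translated back by \<open>x\<close>.\<close>
  have "contains_ip_config r y C" if C: "C \<in> bplus p q" for C
  proof -
    have "{x \<in> PosNat. shift_N x C \<in> q} \<in> p" using C by (simp add: bplus_def)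
    from ultrafilter_nonempty[OF up this] obtain x where "shift_N x C \<in> q" by blast
    then obtain a H where aH: "a \<in> shift_N x C" "finite H" "H \<noteq> {}"
      "\<And>j. j < r \<Longrightarrow> int a + sum (y j) H \<in> int ` shift_N x C"
      using cfg unfolding contains_ip_config_def by meson
    have "int (x + a) + sum (y j) H \<in> int ` C" if "j < r" for j
    proof -
      obtain b where b: "int a + sum (y j) H = int b" "b \<in> shift_N x C" using aH(4)[OF \<open>j < r\<close>] by blast
      then have "int (x + a) + sum (y j) H = int (x + b)" by simp
      moreover have "x + b \<in> C" using b by (simp add: shift_N_def)
      ultimately show ?thesis by blast
    qed
    moreover have "x + a \<in> C" using aH(1) by (simp add: shift_N_def)
    ultimately show ?thesis using aH(2,3) unfolding contains_ip_config_def by meson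
  qed
  then show "bplus p q \<in> ?Q" using ultrafilter_bplus[OF up uq] by (simp add: betaN_def)
  \<comment> \<open>Right multiplication: a configuration has finitely many points, all in
    \<open>?D\<close>, so some \<open>b\<close> lies in all the corresponding shifts of
    \<open>C\<close>; translate by it.\<close>
  have "contains_ip_config r y C" if C: "C \<in> bplus q p" for C
  proof -
    let ?D = "{x \<in> PosNat. shift_N x C \<in> p}"
    have "?D \<in> q" using C by (simp add: bplus_def)
    then obtain a H where aH: "a \<in> ?D" "finite H" "H \<noteq> {}"
      "\<And>j. j < r \<Longrightarrow> int a + sum (y j) H \<in> int ` ?D"
      using cfg unfolding contains_ip_config_def by meson
    have "\<forall>j. \<exists>b. j < r \<longrightarrow> int a + sum (y j) H = int b \<and> b \<in> ?D" using aH(4) by blast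
    then obtain d where d: "\<And>j. j < r \<Longrightarrow> int a + sum (y j) H = int (d j) \<and> d j \<in> ?D" by metis
    have "PosNat \<inter> (\<Inter>e\<in>insert a (d ` {..<r}). shift_N e C) \<in> p"
      by (rule ultrafilter_INT[OF up]) (use aH(1) d in auto)
    then have "PosNat \<inter> (\<Inter>e\<in>insert a (d ` {..<r}). shift_N e C) \<noteq> {}"
      using ultrafilter_empty[OF up] by metis
    then obtain b where b: "\<And>e. e \<in> insert a (d ` {..<r}) \<Longrightarrow> b \<in> shift_N e C" by blast
    have "int (a + b) + sum (y j) H \<in> int ` C" if "j < r" for j
    proof -
      have "int (a + b) + sum (y j) H = int (d j + b)" using d[OF that] by simp
      moreover have "d j + b \<in> C" using b[of "d j"] that by (simp add: shift_N_def)
      ultimately show ?thesis by blast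
    qed
    moreover have "a + b \<in> C" using b[of a] by (simp add: shift_N_def)
    ultimately show ?thesis using aH(2,3) unfolding contains_ip_config_def by meson
  qed
  then show "bplus q p \<in> ?Q" using ultrafilter_bplus[OF uq up] by (simp add: betaN_def)
qed

lemma minimal_idempotent_contains_ip_config:
  assumes "minimal_idempotent p" "C \<in> p"
  shows "contains_ip_config r y C"
proof -
  have "p \<in> \<Inter>{I. two_sided_ideal I}"
    using assms(1) by (simp add: minimal_idempotent_def K_betaN_def)
  then have "p \<in> {q \<in> betaN. \<forall>C\<in>q. contains_ip_config r y C}"
    by (rule InterD) (simp add: two_sided_ideal_ip_ultrafilters)
  then show ?thesis using assms(2) by simp
qed

section \<open>Consequences of idempotency\<close>

text \<open>Some residue class \<open>r\<close> modulo \<open>d\<close> belongs to \<open>p\<close>.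
  Idempotency yields \<open>x\<close>, \<open>y\<close> and \<open>x + y\<close> all in this class,
  which forces \<open>r = 0\<close>.\<close>

lemma idempotent_contains_multiples:
  assumes p: "ultrafilter_N p" and idem: "bplus p p = p" and d: "d > 0"
  shows "{y \<in> PosNat. d dvd y} \<in> p"
proof -
  let ?C = "\<lambda>r. {y \<in> PosNat. y mod d = r}"
  obtain r where r: "?C r \<in> p"
    using ultrafilter_finite_cover[OF p, of "{..<d}" ?C] d by fastforce
  then have "{x \<in> PosNat. shift_N x (?C r) \<in> p} \<in> p"
    using idem by (auto simp: bplus_def)
  then have "?C r \<inter> {x \<in> PosNat. shift_N x (?C r) \<in> p} \<in> p" using r ultrafilter_Int[OF p] by blast
  from ultrafilter_nonempty[OF p this] obtain x where x: "x mod d = r" "shift_N x (?C r) \<in> p"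
    by blast
  then have "?C r \<inter> shift_N x (?C r) \<in> p" using r ultrafilter_Int[OF p] by blast
  from ultrafilter_nonempty[OF p this] obtain y where y: "y mod d = r" "(x + y) mod d = r"
    by (auto simp: shift_N_def)
  have "(x + y) mod d = y mod d" using y by simp
  then have "d dvd x" using mod_eq_dvd_iff_nat[of y "x + y" d] by simp
  then have "r = 0" using x by simp
  then show ?thesis using r by (simp add: dvd_eq_mod_eq_0)
qed

text \<open>The sets \<open>C n\<close> shrink so fast that \<open>s + C (Suc n) \<subseteq> C n\<close> for every value \<open>s\<close> in
  \<open>S n (x n)\<close>; sums are then absorbed starting from the largest index.\<close>

lemma idempotent_sums_sequence:
  fixes S :: "nat \<Rightarrow> 'a \<Rightarrow> nat set"
  assumes p: "ultrafilter_N p" and idem: "bplus p p = p" and B: "\<And>n. B n \<in> p"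
    and ex: "\<And>n C. C \<in> p \<Longrightarrow> \<exists>x. P n x \<and> finite (S n x) \<and> S n x \<subseteq> C"
  obtains x where "\<forall>n. P n (x n)"
    and "\<forall>F a. finite F \<and> F \<noteq> {} \<and> (\<forall>n\<in>F. a n \<in> S n (x n)) \<longrightarrow> sum a F \<in> B (Min F)"
proof -
  \<comment> \<open>By idempotency the elements of \<open>C\<close> whose shift of \<open>C\<close>
    is again in \<open>p\<close> form a member of \<open>p\<close>; the solution is sought
    there.\<close>
  have ex': "\<exists>x. P n x \<and> finite (S n x) \<and> S n x \<subseteq> C \<and> (\<forall>s\<in>S n x. shift_N s C \<in> p)"
    if C: "C \<in> p" for n C
  proof -
    have "{x \<in> PosNat. shift_N x C \<in> p} \<in> p" using C idem by (auto simp: bplus_def)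
    then have "C \<inter> {x \<in> PosNat. shift_N x C \<in> p} \<in> p" using C ultrafilter_Int[OF p] by blast
    from ex[OF this, of n] show ?thesis by blast
  qed
  define I where "I n xC \<longleftrightarrow> snd xC \<in> p \<and> snd xC \<subseteq> B n \<and> P n (fst xC) \<and> finite (S n (fst xC)) \<and>
      S n (fst xC) \<subseteq> snd xC \<and> (\<forall>s\<in>S n (fst xC). shift_N s (snd xC) \<in> p)" for n xC
  define Q where "Q n xC xC' \<longleftrightarrow> snd xC' \<subseteq> snd xC \<and>
      (\<forall>s\<in>S n (fst xC). snd xC' \<subseteq> shift_N s (snd xC))" for n and xC xC' :: "'a \<times> nat set"
  have "\<exists>f. \<forall>n. I n (f n) \<and> Q n (f n) (f (Suc n))"
  proof (rule dependent_nat_choice)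
    obtain x where "P 0 x \<and> finite (S 0 x) \<and> S 0 x \<subseteq> B 0 \<and> (\<forall>s\<in>S 0 x. shift_N s (B 0) \<in> p)"
      using ex'[OF B] by blast
    then show "\<exists>xC. I 0 xC" by (intro exI[of _ "(x, B 0)"]) (simp add: I_def B)
  next
    fix xC n assume "I n xC"
    then have I: "snd xC \<in> p" "finite (S n (fst xC))" "\<And>s. s \<in> S n (fst xC) \<Longrightarrow> shift_N s (snd xC) \<in> p"
      by (auto simp: I_def)
    define D where "D = (B (Suc n) \<inter> snd xC) \<inter> (PosNat \<inter> (\<Inter>s\<in>S n (fst xC). shift_N s (snd xC)))"
    have D: "D \<in> p" unfolding D_def
      using I B by (intro ultrafilter_Int[OF p] ultrafilter_INT[OF p]) auto
    obtain x where "P (Suc n) x \<and> finite (S (Suc n) x) \<and> S (Suc n) x \<subseteq> D \<and>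
        (\<forall>s\<in>S (Suc n) x. shift_N s D \<in> p)"
      using ex'[OF D] by blast
    then have "I (Suc n) (x, D)" using D by (auto simp: I_def D_def)
    moreover have "Q n xC (x, D)" by (auto simp: Q_def D_def)
    ultimately show "\<exists>xC'. I (Suc n) xC' \<and> Q n xC xC'" by blast
  qed
  then obtain f where f: "\<And>n. I n (f n)" "\<And>n. Q n (f n) (f (Suc n))" by blast
  define x where "x n = fst (f n)" for n
  define C where "C n = snd (f n)" for n
  have x: "P n (x n)" "C n \<subseteq> B n" "S n (x n) \<subseteq> C n" for n
    using f(1)[of n] by (auto simp: I_def x_def C_def)
  have C_Suc: "C (Suc n) \<subseteq> C n" "s \<in> S n (x n) \<Longrightarrow> C (Suc n) \<subseteq> shift_N s (C n)" for n s
    using f(2)[of n] by (auto simp: Q_def x_def C_def)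
  have C_anti: "C n \<subseteq> C m" if "m \<le> n" for m n
    using that by (induction rule: dec_induct) (use C_Suc in auto)
  have C_sum: "sum a F \<in> C (Min F)"
    if "finite F" "F \<noteq> {}" "\<And>n. n \<in> F \<Longrightarrow> a n \<in> S n (x n)" for F a
    using that
  proof (induction "card F" arbitrary: F)
    case 0
    then show ?case by simp
  next
    case (Suc k)
    define m where "m = Min F"
    have mF: "m \<in> F" using Suc.prems by (simp add: m_def)
    have am: "a m \<in> S m (x m)" using Suc.prems(3) mF by blast
    have split: "sum a F = a m + sum a (F - {m})" using Suc.prems(1) mF by (simp add: sum.remove)
    show ?case
    proof (cases "F - {m} = {}")
      case True
      then show ?thesis using split am x(3)[of m] unfolding True by (auto simp: m_def)
    next
      case False
      have "sum a (F - {m}) \<in> C (Min (F - {m}))"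
        using Suc False mF by (intro Suc.hyps(1)) auto
      \<comment> \<open>The remaining sum thus lies in \<open>C (Suc m)\<close>, and adding
        \<open>a m\<close> leads back into \<open>C m\<close>.\<close>
      moreover have "Suc m \<le> Min (F - {m})"
      proof -
        have "Min (F - {m}) \<in> F - {m}" using Suc.prems(1) False by (intro Min_in) auto
        then show ?thesis using Suc.prems(1) Min_le[of F "Min (F - {m})"]
          by (metis DiffD1 DiffD2 Suc_leI insertI1 le_neq_implies_less m_def)
      qed
      ultimately have "sum a (F - {m}) \<in> shift_N (a m) (C m)"
        using C_anti C_Suc(2)[OF am] by blast
      then show ?thesis by (simp add: split shift_N_def m_def)
    qed
  qed
  show ?thesis
    by (rule that[of x]) (simp_all add: x(1) subsetD[OF x(2) C_sum])
qed

subsection \<open>Images of matrices in members of minimal idempotents\<close>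

text \<open>Entries that are not natural numbers are silently dropped, so integrality of the rows
  has to be recorded separately wherever this set is used.\<close>

definition row_values :: "nat \<Rightarrow> (nat \<Rightarrow> nat \<Rightarrow> rat) \<Rightarrow> nat set \<Rightarrow> (nat \<Rightarrow> nat) \<Rightarrow> nat set" where
  "row_values v A I x = {k. \<exists>i\<in>I. mat_row v A x i = of_nat k}"

lemma finite_row_values:
  assumes "finite I"
  shows "finite (row_values v A I x)"
proof (rule finite_subset)
  show "row_values v A I x \<subseteq> (\<lambda>i. nat \<lfloor>mat_row v A x i\<rfloor>) ` I"
    by (force simp: row_values_def image_iff)
qed (use assms in simp)

lemma row_values_subset:
  assumes "\<forall>i\<in>I. mat_row v A x i \<in> of_nat ` C"
  shows "row_values v A I x \<subseteq> C"
  using assms by (fastforce simp: row_values_def)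

text \<open>The divisor \<open>d\<close> lets the next induction step clear the denominators of \<open>A\<close>.\<close>

definition good_rows ::
    "nat set set \<Rightarrow> nat \<Rightarrow> (nat \<Rightarrow> nat \<Rightarrow> rat) \<Rightarrow> nat set \<Rightarrow> bool" where
  "good_rows p v A R \<longleftrightarrow> (\<forall>C\<in>p. \<forall>d>0. \<exists>x. (\<forall>j<v. x j \<in> PosNat \<and> d dvd x j) \<and>
     (\<forall>i\<in>R. mat_row v A x i \<in> of_nat ` C))"

lemma good_rows_empty: "good_rows p v A {}"
  unfolding good_rows_def
proof (intro ballI allI impI)
  fix C d assume "(d::nat) > 0"
  then show "\<exists>x. (\<forall>j<v. x j \<in> PosNat \<and> d dvd x j) \<and> (\<forall>i\<in>{}. mat_row v A x i \<in> of_nat ` C)"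
    by (intro exI[of _ "\<lambda>_. d"]) auto
qed

lemma common_denominator:
  fixes S :: "rat set"
  assumes "finite S"
  shows "\<exists>D::nat. D > 0 \<and> (\<forall>q\<in>S. of_nat D * q \<in> \<int>)"
  using assms
proof (induction S rule: finite_induct)
  case empty
  then show ?case by auto
next
  case (insert q S)
  then obtain D where D: "(D::nat) > 0" "\<And>q. q \<in> S \<Longrightarrow> of_nat D * q \<in> \<int>" by blast
  obtain a b where ab: "quotient_of q = (a, b)" by force
  then have b: "b > 0" and q: "q = of_int a / of_int b"
    by (simp_all add: quotient_of_denom_pos quotient_of_div)
  show ?case
  proof (intro exI[of _ "D * nat b"] conjI ballI)
    show "D * nat b > 0" using D b by simp
    have nb: "(of_nat (nat b) :: rat) = of_int b" using b by simp
    fix r assume "r \<in> insert q S"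
    then consider "r = q" | "r \<in> S" by blast
    then show "of_nat (D * nat b) * r \<in> \<int>"
    proof cases
      case 1
      have "of_nat (D * nat b) * r = of_int (int D * a)" using b unfolding 1 q of_nat_mult nb by simp
      then show ?thesis by (simp only: Ints_of_int)
    next
      case 2
      have "of_nat (D * nat b) * r = of_int b * (of_nat D * r)" unfolding of_nat_mult nb by simp
      moreover have "of_int b * (of_nat D * r) \<in> \<int>" by (rule Ints_mult[OF Ints_of_int D(2)[OF 2]])
      ultimately show ?thesis by (simp only:)
    qed
  qed
qed

lemma good_rows_Un:
  assumes p: "minimal_idempotent p" and R: "good_rows p v A R" "R \<subseteq> {..<u}" and J: "J \<subseteq> {..<u}"
    and g0: "\<And>j. j < v \<Longrightarrow> g j \<ge> 0"
    and gJ: "\<And>i. i \<in> J \<Longrightarrow> (\<Sum>j<v. A i j * g j) = 1"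
    and gR: "\<And>i. i \<in> R \<Longrightarrow> (\<Sum>j<v. A i j * g j) = 0"
  shows "good_rows p v A (R \<union> J)"
  unfolding good_rows_def
proof (intro ballI allI impI)
  fix C and d :: nat assume C: "C \<in> p" and d: "d > 0"
  have up: "ultrafilter_N p" and idem: "bplus p p = p"
    using p by (auto simp: minimal_idempotent_def betaN_def)
  obtain D :: nat where D: "D > 0" "\<And>i j. i < u \<Longrightarrow> j < v \<Longrightarrow> of_nat D * A i j \<in> \<int>"
    using common_denominator[of "(\<lambda>(i, j). A i j) ` ({..<u} \<times> {..<v})"] by auto
  obtain E :: nat where E: "E > 0" "\<And>j. j < v \<Longrightarrow> of_nat E * g j \<in> \<int>"
    using common_denominator[of "g ` {..<v}"] by auto
  \<comment> \<open>\<open>E\<close> clears the denominators of \<open>g\<close>, so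
    \<open>a g\<close> is integral once \<open>E\<close> divides \<open>a\<close>.\<close>
  define g' where "g' j = nat \<lfloor>of_nat E * g j\<rfloor>" for j
  have g': "of_nat (g' j) = of_nat E * g j" if "j < v" for j
  proof -
    have "0 \<le> of_nat E * g j" using g0[OF that] by simp
    then show ?thesis using E(2)[OF that] by (auto simp: g'_def elim!: Ints_cases)
  qed
  \<comment> \<open>Divisibility by \<open>D\<close> makes every row of \<open>A x\<close> integral,
    including the rows in \<open>J\<close>, whose values are otherwise uncontrolled.\<close>
  define P where "P n x \<longleftrightarrow> (\<forall>j<v. x j \<in> PosNat \<and> d * D dvd x j) \<and>
      (\<forall>i\<in>R. mat_row v A x i \<in> of_nat ` UNIV)" for n :: nat and x
  have finR: "finite R" using R(2) finite_subset by blast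
  have ex: "\<exists>x. P n x \<and> finite (row_values v A R x) \<and> row_values v A R x \<subseteq> C'"
    if "C' \<in> p" for n C'
  proof -
    from that obtain x where x: "\<forall>j<v. x j \<in> PosNat \<and> d * D dvd x j"
      "\<forall>i\<in>R. mat_row v A x i \<in> of_nat ` C'"
      using R(1) d D(1) unfolding good_rows_def by (metis nat_0_less_mult_iff)
    have "P n x" using x by (auto simp: P_def)
    then show ?thesis
      using finite_row_values[OF finR] row_values_subset[OF x(2)] by blast
  qed
  obtain x where x: "\<forall>n. P n (x n)" and sums: "\<forall>F a. finite F \<and> F \<noteq> {} \<and>
      (\<forall>n\<in>F. a n \<in> row_values v A R (x n)) \<longrightarrow> sum a F \<in> C"
    by (rule idempotent_sums_sequence[where P = P and S = "\<lambda>_. row_values v A R", OF up idem C ex])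
  have x_pos: "x n j \<ge> 1" and x_dvd: "d * D dvd x n j" if "j < v" for n j
    using x that by (auto simp: P_def)
  have row_int: "mat_row v A (x t) i \<in> \<int>" if "i < u" for t i
    unfolding mat_row_def
  proof (rule Ints_sum)
    fix j assume "j \<in> {..<v}"
    then have j: "j < v" by simp
    obtain z where z: "x t j = d * D * z" using x_dvd[OF j] by blast
    have "A i j * of_nat (x t j) = of_nat (d * z) * (of_nat D * A i j)" unfolding z by simp
    moreover have "of_nat (d * z) * (of_nat D * A i j) \<in> \<int>"
      by (rule Ints_mult[OF Ints_of_nat D(2)[OF that j]])
    ultimately show "A i j * of_nat (x t j) \<in> \<int>" by (simp only:)
  qed
  \<comment> \<open>Zero sequences pad the family to the index range below \<open>u\<close>. Rows in
    \<open>J\<close> may take negative values here.\<close>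
  define y where "y i t = (if i \<in> J then \<lfloor>mat_row v A (x t) i\<rfloor> else 0)" for i t
  have y: "of_int (y i t) = mat_row v A (x t) i" if "i \<in> J" for i t
    using row_int[of i t] that J by (auto simp: y_def elim!: Ints_cases)
  have "C \<inter> {n \<in> PosNat. E * d dvd n} \<in> p"
    using C E(1) d by (intro ultrafilter_Int[OF up] idempotent_contains_multiples[OF up idem]) auto
  from minimal_idempotent_contains_ip_config[OF p this, of u y]
  obtain a H where aC: "a \<in> C" "E * d dvd a" and H: "finite H" "H \<noteq> {}"
    and aH: "\<And>i. i < u \<Longrightarrow> int a + sum (y i) H \<in> int ` (C \<inter> {n \<in> PosNat. E * d dvd n})"
    unfolding contains_ip_config_def by auto
  obtain b where b: "a = E * d * b" using aC(2) by blast
  \<comment> \<open>With \<open>a = E * d * b\<close>, the first summand is \<open>a * g j\<close>.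
    It contributes \<open>a\<close> to the rows in \<open>J\<close> and 0 to those in
    \<open>R\<close>.\<close>
  define x' where "x' j = d * b * g' j + (\<Sum>t\<in>H. x t j)" for j
  have row: "mat_row v A x' i = of_nat a * (\<Sum>j<v. A i j * g j) + (\<Sum>t\<in>H. mat_row v A (x t) i)" for i
  proof -
    have "mat_row v A x' i = (\<Sum>j<v. A i j * (of_nat (d * b) * of_nat (g' j)) + (\<Sum>t\<in>H. A i j * of_nat (x t j)))"
      unfolding mat_row_def x'_def by (simp add: distrib_left sum_distrib_left)
    also have "\<dots> = (\<Sum>j<v. of_nat a * (A i j * g j) + (\<Sum>t\<in>H. A i j * of_nat (x t j)))"
      by (rule sum.cong) (auto simp: g' b)
    also have "\<dots> = of_nat a * (\<Sum>j<v. A i j * g j) + (\<Sum>t\<in>H. mat_row v A (x t) i)"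
      unfolding mat_row_def sum.distrib sum_distrib_left
      using sum.swap[of "\<lambda>j t. A i j * of_nat (x t j)" H "{..<v}"] by simp
    finally show ?thesis .
  qed
  have "x' j \<in> PosNat \<and> d dvd x' j" if j: "j < v" for j
  proof
    \<comment> \<open>Since \<open>g j\<close> may be 0, positivity comes from the nonempty sum over
      \<open>H\<close>.\<close>
    obtain t where "t \<in> H" using H by blast
    then have "x t j \<le> (\<Sum>t\<in>H. x t j)" using H(1) by (intro member_le_sum) auto
    then show "x' j \<in> PosNat" using x_pos[OF j, of t] by (simp add: x'_def)
    show "d dvd x' j" unfolding x'_def using x_dvd[OF j]
      by (intro dvd_add dvd_sum) (auto intro: dvd_mult_left)
  qed
  moreover have "mat_row v A x' i \<in> of_nat ` C" if i: "i \<in> R \<union> J" for i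
  proof (cases "i \<in> R")
    case True
    have "\<exists>k. mat_row v A (x t) i = of_nat k" for t
    proof -
      have "mat_row v A (x t) i \<in> range of_nat" using x True by (simp add: P_def)
      then show ?thesis by (elim rangeE) (rule exI)
    qed
    then obtain k where k: "\<And>t. mat_row v A (x t) i = of_nat (k t)" by metis
    then have "sum k H \<in> C" using H True by (intro sums[rule_format]) (auto simp: row_values_def)
    moreover have "mat_row v A x' i = of_nat (sum k H)" using row[of i] gR[OF True] k by simp
    ultimately show ?thesis by blast
  next
    case False
    then have iJ: "i \<in> J" using i by blast
    then have "int a + sum (y i) H \<in> int ` (C \<inter> {n \<in> PosNat. E * d dvd n})" using aH J by blast
    then obtain k where k: "int a + sum (y i) H = int k" "k \<in> C" by blast
    have "mat_row v A x' i = of_int (int a + sum (y i) H)" using row[of i] gJ[OF iJ] y[OF iJ] by simp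
    then have "mat_row v A x' i = of_nat k" unfolding k by simp
    then show ?thesis using k(2) by blast
  qed
  ultimately show "\<exists>x. (\<forall>j<v. x j \<in> PosNat \<and> d dvd x j) \<and> (\<forall>i\<in>R \<union> J. mat_row v A x i \<in> of_nat ` C)"
    by blast
qed

text \<open>Colour \<open>n\<close> by \<open>\<lfloor>log b n\<rfloor> mod Suc N\<close> with \<open>b = 1 + \<epsilon>\<close>: two numbers of the same colour either
  have the same logarithm class or differ by a factor of at least \<open>b ^ N > 1 / \<epsilon>\<close>.\<close>

lemma image_partition_regular_separated:
  fixes \<epsilon> :: real
  assumes ipr: "image_partition_regular u v A" and eps: "\<epsilon> > 0"
  obtains x y and L :: "nat \<Rightarrow> nat" where
    "\<forall>i<u. mat_row v A x i = of_nat (y i) \<and> y i \<ge> 1"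
    "\<forall>i<u. \<forall>i'<u. L i = L i' \<longrightarrow> real (y i) \<le> (1 + \<epsilon>) * real (y i')"
    "\<forall>i<u. \<forall>i'<u. L i < L i' \<longrightarrow> real (y i) \<le> \<epsilon> * real (y i')"
proof -
  define b where "b = 1 + \<epsilon>"
  have b: "b > 1" using eps by (simp add: b_def)
  obtain N where N: "1 / \<epsilon> < b ^ N" using real_arch_pow[OF b] by blast
  define l where "l n = nat \<lfloor>log b (real n)\<rfloor>" for n
  have l: "b ^ l n \<le> real n" "real n < b ^ Suc (l n)" if "n \<ge> 1" for n
  proof -
    have "\<lfloor>log b (real n)\<rfloor> \<ge> 0" using that b by (simp add: zero_le_log_cancel_iff)
    then have "\<lfloor>log b (real n)\<rfloor> = int (l n)" by (simp add: l_def)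
    then have "b powr real (l n) \<le> real n \<and> real n < b powr (real (l n) + 1)"
      using that b by (subst (asm) floor_log_eq_powr_iff) auto
    then show "b ^ l n \<le> real n" "real n < b ^ Suc (l n)"
      using b by (simp_all add: powr_realpow powr_add mult.commute)
  qed
  define c where "c n = l n mod Suc N" for n
  have "\<forall>n\<in>PosNat. c n < Suc N" by (simp add: c_def)
  from ipr[unfolded image_partition_regular_def, THEN spec, THEN spec, THEN mp, OF this]
  obtain x col where "\<forall>i<u. \<exists>n\<in>PosNat. mat_row v A x i = of_nat n \<and> c n = col"
    by (elim exE conjE)
  then have "\<forall>i. \<exists>n. i < u \<longrightarrow> n \<ge> 1 \<and> mat_row v A x i = of_nat n \<and> c n = col"
    by auto
  then have "\<exists>y. \<forall>i. i < u \<longrightarrow> y i \<ge> 1 \<and> mat_row v A x i = of_nat (y i) \<and> c (y i) = col"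
    by (rule choice)
  then obtain y where y: "\<And>i. i < u \<Longrightarrow> y i \<ge> 1 \<and> mat_row v A x i = of_nat (y i) \<and> c (y i) = col"
    by blast
  have yl: "b ^ l (y i) \<le> real (y i)" "real (y i) \<le> b ^ Suc (l (y i))" if "i < u" for i
    using l[OF conjunct1[OF y[OF that]]] by (auto intro: less_imp_le)
  have same: "real (y i) \<le> (1 + \<epsilon>) * real (y i')" if "i < u" "i' < u" "l (y i) = l (y i')" for i i'
  proof -
    have "real (y i) \<le> b * b ^ l (y i')" using yl(2)[OF that(1)] unfolding that(3) by simp
    also have "\<dots> \<le> b * real (y i')" using yl(1)[OF that(2)] b by (intro mult_left_mono) auto
    finally show ?thesis by (simp add: b_def)
  qed
  have far: "real (y i) \<le> \<epsilon> * real (y i')" if "i < u" "i' < u" "l (y i) < l (y i')" for i i'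
  proof -
    have "l (y i) mod Suc N = l (y i') mod Suc N" using y that by (simp add: c_def)
    then have "Suc N dvd l (y i') - l (y i)" using that(3) mod_eq_dvd_iff_nat
      by (metis less_imp_le)
    \<comment> \<open>One of the \<open>Suc N\<close> levels is spent on the upper bound
      \<open>b ^ Suc (l (y i))\<close>; the other \<open>N\<close> give the factor
      \<open>b ^ N\<close>.\<close>
    then have "Suc N \<le> l (y i') - l (y i)" using that(3) by (intro dvd_imp_le) auto
    then have le: "Suc (l (y i)) + N \<le> l (y i')" by simp
    have "real (y i) * b ^ N \<le> b ^ Suc (l (y i)) * b ^ N"
      using yl(2)[OF that(1)] b by (intro mult_right_mono) auto
    also have "\<dots> = b ^ (Suc (l (y i)) + N)" by (rule power_add[symmetric])
    also have "\<dots> \<le> b ^ l (y i')" using le b by (intro power_increasing) auto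
    also have "\<dots> \<le> real (y i')" by (rule yl(1)[OF that(2)])
    finally have "real (y i) * b ^ N \<le> real (y i')" .
    moreover have "real (y i) * (1 / \<epsilon>) \<le> real (y i) * b ^ N" using N by (intro mult_left_mono) auto
    ultimately have "real (y i) / \<epsilon> \<le> real (y i')" by simp
    then show ?thesis using eps by (simp add: pos_divide_le_eq mult.commute)
  qed
  show ?thesis
    by (rule that[of x y "\<lambda>i. l (y i)"]) (simp_all add: y same far)
qed

lemma image_partition_regular_good_rows:
  assumes p: "minimal_idempotent p" and ipr: "image_partition_regular u v A"
  shows "good_rows p v A {..<u}"
proof -
  define approx where "approx R J e \<longleftrightarrow> (\<exists>g. (\<forall>j<v. g j \<ge> 0) \<and>
      (\<forall>i\<in>R \<union> J. \<bar>(\<Sum>j<v. A i j * g j) - (if i \<in> J then 1 else 0)\<bar> \<le> e))" for R J and e :: rat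
  \<comment> \<open>If approximation succeeds for every \<open>e\<close>, closedness of the cone
    makes it exact and any \<open>e\<close> will do; otherwise take an \<open>e\<close> for which it
    fails.\<close>
  have "\<exists>e>0. approx R J e \<longrightarrow> approx R J 0" if "R \<subseteq> {..<u}" "J \<subseteq> {..<u}" for R J
  proof (cases "\<forall>e>0. approx R J e")
    case True
    have "finite (R \<union> J)" using that finite_subset[of _ "{..<u}"] by simp
    then have "\<exists>g. (\<forall>j<v. g j \<ge> 0) \<and> (\<forall>i\<in>R \<union> J. (\<Sum>j<v. A i j * g j) = (if i \<in> J then 1 else 0))"
      using True unfolding approx_def by (intro cone_approx_imp_exact) blast+
    then show ?thesis unfolding approx_def by (intro exI[of _ 1]) auto
  next
    case False
    then show ?thesis by blast
  qed
  then obtain e where e: "\<And>R J. R \<subseteq> {..<u} \<Longrightarrow> J \<subseteq> {..<u} \<Longrightarrow> e R J > 0 \<and> (approx R J (e R J) \<longrightarrow> approx R J 0)"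
    by metis
  let ?E = "(\<lambda>(R, J). e R J) ` (Pow {..<u} \<times> Pow {..<u})"
  \<comment> \<open>The classes are known only after the colouring is fixed, and the colouring
    depends on \<open>\<epsilon>\<close>; so one \<open>\<epsilon>\<close> must serve all pairs of
    row sets.\<close>
  define \<epsilon> where "\<epsilon> = Min ?E"
  have finE: "finite ?E" "?E \<noteq> {}" by auto
  have eps: "\<epsilon> > 0" using e finE by (auto simp: \<epsilon>_def)
  have exact: "approx R J 0" if "R \<subseteq> {..<u}" "J \<subseteq> {..<u}" "approx R J \<epsilon>" for R J
  proof -
    have "\<epsilon> \<le> e R J" unfolding \<epsilon>_def using that finE by (intro Min_le) auto
    then have "approx R J (e R J)" using that(3) unfolding approx_def by (meson order_trans)
    then show ?thesis using e that by blast
  qed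
  have eps': "real_of_rat \<epsilon> > 0" using eps by simp
  obtain x y and L :: "nat \<Rightarrow> nat" where y_all: "\<forall>i<u. mat_row v A x i = of_nat (y i) \<and> y i \<ge> 1"
    and near: "\<forall>i<u. \<forall>i'<u. L i = L i' \<longrightarrow> real (y i) \<le> (1 + real_of_rat \<epsilon>) * real (y i')"
    and far: "\<forall>i<u. \<forall>i'<u. L i < L i' \<longrightarrow> real (y i) \<le> real_of_rat \<epsilon> * real (y i')"
    by (rule image_partition_regular_separated[OF ipr eps'])
  note y = y_all[rule_format]
  have near': "of_nat (y i) \<le> (1 + \<epsilon>) * of_nat (y i')" if "i < u" "i' < u" "L i = L i'" for i i'
  proof -
    have "real_of_rat (of_nat (y i)) \<le> real_of_rat ((1 + \<epsilon>) * of_nat (y i'))"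
      using near[rule_format, OF that] by (simp add: of_rat_mult of_rat_add)
    then show ?thesis by (simp only: of_rat_less_eq)
  qed
  have far': "of_nat (y i) \<le> \<epsilon> * of_nat (y i')" if "i < u" "i' < u" "L i < L i'" for i i'
  proof -
    have "real_of_rat (of_nat (y i)) \<le> real_of_rat (\<epsilon> * of_nat (y i'))"
      using far[rule_format, OF that] by (simp add: of_rat_mult)
    then show ?thesis by (simp only: of_rat_less_eq)
  qed
  have all: "{i \<in> {..<u}. L i < Suc (\<Sum>i<u. L i)} = {..<u}"
    using member_le_sum[of _ "{..<u}" L] by (auto simp: less_Suc_eq_le)
  have "good_rows p v A {i \<in> {..<u}. L i < k}" for k
  proof (induction k)
    case 0
    then show ?case by (simp add: good_rows_empty)
  next
    case (Suc k)
    define R where "R = {i \<in> {..<u}. L i < k}"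
    define J where "J = {i \<in> {..<u}. L i = k}"
    have RJ: "{i \<in> {..<u}. L i < Suc k} = R \<union> J" by (auto simp: R_def J_def)
    show ?case
    proof (cases "J = {}")
      case True
      then show ?thesis using Suc unfolding RJ R_def by simp
    next
      case False
      then obtain i0 where i0: "i0 < u" "L i0 = k" by (auto simp: J_def)
      define g where "g j = of_nat (x j) / (of_nat (y i0) :: rat)" for j
      have y0: "(0::rat) < of_nat (y i0)" using y[OF i0(1)] by simp
      have row: "(\<Sum>j<v. A i j * g j) = of_nat (y i) / of_nat (y i0)" if "i < u" for i
        using y[OF that] by (simp add: g_def mat_row_def sum_divide_distrib[symmetric])
      have "approx R J \<epsilon>"
        unfolding approx_def
      proof (intro exI[of _ g] conjI allI impI ballI)
        show "g j \<ge> 0" for j by (simp add: g_def)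
        fix i assume "i \<in> R \<union> J"
        then consider "i < u" "L i < k" "i \<notin> J" | "i < u" "L i = k" "i \<in> J"
          by (auto simp: R_def J_def)
        then show "\<bar>(\<Sum>j<v. A i j * g j) - (if i \<in> J then 1 else 0)\<bar> \<le> \<epsilon>"
        proof cases
          case 1
          then have "of_nat (y i) / of_nat (y i0) \<le> \<epsilon>"
            using far'[of i i0] i0 y0 by (simp add: pos_divide_le_eq)
          then show ?thesis using 1 row[of i] by simp
        next
          case 2
          let ?q = "of_nat (y i) / of_nat (y i0) :: rat"
          have "?q \<le> 1 + \<epsilon>" using near'[of i i0] 2 i0 y0 by (simp add: pos_divide_le_eq)
          \<comment> \<open>Exchanging the two rows gives the lower bound
            \<open>1 / (1 + \<epsilon>)\<close>, which is at least
            \<open>1 - \<epsilon>\<close>.\<close>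
          moreover have "1 \<le> (1 + \<epsilon>) * ?q" using near'[of i0 i] 2 i0 y0 by (simp add: pos_le_divide_eq)
          moreover have "(1 - \<epsilon>) * (1 + \<epsilon>) \<le> 1" by (simp add: algebra_simps)
          ultimately have "(1 + \<epsilon>) * (1 - \<epsilon>) \<le> (1 + \<epsilon>) * ?q" by (simp add: mult.commute)
          then have "1 - \<epsilon> \<le> ?q" using eps by (simp only: mult_le_cancel_left_pos)
          then show ?thesis using 2 row[of i] \<open>?q \<le> 1 + \<epsilon>\<close> by (simp add: abs_le_iff)
        qed
      qed
      then have "approx R J 0" by (intro exact) (auto simp: R_def J_def)
      then obtain h where h: "\<And>j. j < v \<Longrightarrow> h j \<ge> 0"
        "\<And>i. i \<in> R \<union> J \<Longrightarrow> (\<Sum>j<v. A i j * h j) = (if i \<in> J then 1 else 0)"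
        unfolding approx_def by auto
      show ?thesis unfolding RJ
      proof (rule good_rows_Un[OF p, where u = u and g = h])
        show "good_rows p v A R" using Suc by (simp add: R_def)
        show "(\<Sum>j<v. A i j * h j) = 0" if "i \<in> R" for i
          using h(2)[of i] that by (auto simp: R_def J_def)
      qed (use h in \<open>auto simp: R_def J_def\<close>)
    qed
  qed
  from this[of "Suc (\<Sum>i<u. L i)"] show ?thesis by (simp only: all)
qed

section \<open>Combining the matrices\<close>

theorem theorem2p1:
  fixes p :: "nat set set"
    and B :: "nat \<Rightarrow> nat set"
    and A :: "nat \<Rightarrow> nat \<Rightarrow> nat \<Rightarrow> rat"
    and u m :: "nat \<Rightarrow> nat"
  assumes "minimal_idempotent p"
    and "\<forall>n\<in>PosNat. B n \<in> p"
    and "\<forall>n\<in>PosNat. image_partition_regular (u n) (m n) (A n)"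
  shows "\<exists>x :: nat \<Rightarrow> nat \<Rightarrow> nat.
           (\<forall>n\<in>PosNat. \<forall>j<m n. x n j \<in> PosNat) \<and>
           (\<forall>F. finite F \<and> F \<noteq> {} \<and> F \<subseteq> PosNat \<longrightarrow>
              sumset F (\<lambda>n. {mat_row (m n) (A n) (x n) i | i. i < u n})
                \<subseteq> of_nat ` B (Min F))"
proof -
  have up: "ultrafilter_N p" and idem: "bplus p p = p"
    using assms(1) by (auto simp: minimal_idempotent_def betaN_def)
  \<comment> \<open>\<open>idempotent_sums_sequence\<close> is indexed from 0, so index 0 receives
    trivial data; no admissible \<open>F\<close> contains it.\<close>
  define B' where "B' n = (if n = 0 then PosNat else B n)" for n
  define S where "S n x = (if n = 0 then {} else row_values (m n) (A n) {..<u n} x)" for n x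
  define P where "P n x \<longleftrightarrow> n = 0 \<or> (\<forall>j<m n. x j \<in> PosNat) \<and>
      (\<forall>i<u n. mat_row (m n) (A n) x i \<in> range of_nat)" for n and x :: "nat \<Rightarrow> nat"
  have B': "B' n \<in> p" for n using assms(2) ultrafilter_PosNat[OF up] by (simp add: B'_def)
  have ex: "\<exists>x. P n x \<and> finite (S n x) \<and> S n x \<subseteq> C" if C: "C \<in> p" for n C
  proof (cases "n = 0")
    case False
    then have "good_rows p (m n) (A n) {..<u n}"
      using assms(1,3) by (intro image_partition_regular_good_rows) auto
    then obtain x where x: "\<forall>j<m n. x j \<in> PosNat \<and> 1 dvd x j"
      "\<forall>i\<in>{..<u n}. mat_row (m n) (A n) x i \<in> of_nat ` C"
      using C unfolding good_rows_def by (meson zero_less_one)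
    have "mat_row (m n) (A n) x i \<in> range of_nat" if "i < u n" for i
      using x(2) that by (meson image_mono lessThan_iff subsetD subset_UNIV)
    then have "P n x" using x(1) by (simp add: P_def)
    then show ?thesis
      using False finite_row_values[of "{..<u n}"] row_values_subset[OF x(2)]
      by (intro exI[of _ x]) (simp add: S_def)
  qed (simp add: P_def S_def)
  obtain x where x: "\<forall>n. P n (x n)" and sums: "\<forall>F a. finite F \<and> F \<noteq> {} \<and>
      (\<forall>n\<in>F. a n \<in> S n (x n)) \<longrightarrow> sum a F \<in> B' (Min F)"
    by (rule idempotent_sums_sequence[where P = P and S = S and B = B', OF up idem B' ex])
  have "sumset F (\<lambda>n. {mat_row (m n) (A n) (x n) i | i. i < u n}) \<subseteq> of_nat ` B (Min F)"
    if F: "finite F" "F \<noteq> {}" "F \<subseteq> PosNat" for F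
  proof
    fix s assume "s \<in> sumset F (\<lambda>n. {mat_row (m n) (A n) (x n) i | i. i < u n})"
    then obtain a where a: "s = sum a F" "\<And>n. n \<in> F \<Longrightarrow> a n \<in> {mat_row (m n) (A n) (x n) i | i. i < u n}"
      unfolding sumset_def by blast
    have "\<exists>k. a n = of_nat k \<and> k \<in> S n (x n)" if n: "n \<in> F" for n
    proof -
      obtain i where i: "i < u n" "a n = mat_row (m n) (A n) (x n) i" using a(2)[OF n] by blast
      have n0: "n \<noteq> 0" using n F(3) by auto
      then obtain k where "a n = of_nat k" using x[rule_format, of n] i by (auto simp: P_def)
      then show ?thesis using i n0 by (auto simp: S_def row_values_def)
    qed
    then obtain k where k: "\<And>n. n \<in> F \<Longrightarrow> a n = of_nat (k n) \<and> k n \<in> S n (x n)" by metis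
    have "Min F \<noteq> 0" using F Min_in[of F] by auto
    then have "B' (Min F) = B (Min F)" unfolding B'_def by (rule if_not_P)
    then have "sum k F \<in> B (Min F)" using sums[rule_format, of F k] F k by simp
    moreover have "s = of_nat (sum k F)" using a(1) k by simp
    ultimately show "s \<in> of_nat ` B (Min F)" by blast
  qed
  moreover have "x n j \<in> PosNat" if "n \<in> PosNat" "j < m n" for n j
    using x[rule_format, of n] that by (auto simp: P_def)
  ultimately show ?thesis by blast
qed

end
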